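(* Assume the setup below. Let $\boldsymbol{\lambda},\boldsymbol{\mu}\in\mathcal{P}(l,n)$. Then $\tau_{\mathbf{r}}(w(\boldsymbol{\lambda}))_J=\tau_{\mathbf{r}}(w(\boldsymbol{\mu}))_J$ if and only if $$\sum_{i=0}^{l-1}x^{\overline{m}_i}\,\mathrm{Res}_{\lambda^{(i)}}(x^d)=\sum_{i=0}^{l-1}x^{\overline{m}_i}\,\mathrm{Res}_{\mu^{(i)}}(x^d)\quad\text{in }\mathbb{Z}[x,x^{-1}],$$ where $\overline{m}_i=d(H_1+\dots+H_i)$ (so $\overline{m}_0=0$) and $\mathrm{Res}_\nu(x)=\sum_{(a,b)\in Y(\nu)}x^{b-a}$.
   Context: Fix positive integers $l,n$. A partition $\lambda=(\lambda_1\ge\lambda_2\ge\dots)$ has $\lambda_i=0$ for large $i$; its Young diagram is $Y(\lambda)=\{(a,b)\in\mathbb{Z}^2:a\ge1,\,1\le b\le\lambda_a\}$ and the content of a node $(a,b)$ is $b-a$. An $l$-multipartition of $n$ is an $l$-tuple $\boldsymbol{\lambda}=(\lambda^{(0)},\dots,\lambda^{(l-1)})$ of partitions with $\sum|\lambda^{(i)}|=n$; $\mathcal{P}(l,n)$ is their set. For $r\in\mathbb{Z}$ the $r$-shifted $\beta$-number of $\lambda$ is the strictly decreasing sequence $\beta^r(\lambda)=(\lambda_i+r+1-i)_{i\ge1}$, and $\beta(\lambda)=\beta^0(\lambda)$. A strictly decreasing integer sequence $C=(C_1,C_2,\dots)$ stabilises with respect to $r$ if $C_i=r+1-i$ for all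 large $i$; every such $C$ equals $\beta^r(\lambda)$ for a unique partition $\lambda$. For an $l$-tuple $\mathbf{C}=(C^0,\dots,C^{l-1})$ of strictly decreasing integer sequences, $\chi(\mathbf{C})=\{l(C^q_i-1)+q+1:0\le q\le l-1,\ i\ge1\}$. A node of $Y(\lambda)$ is removable if deleting it leaves the Young diagram of a partition; for $J\subseteq\{0,\dots,l-1\}$ it is $J$-removable if it is removable and its content is congruent mod $l$ to some $j\in J$. The $J$-heart $\lambda_J$ is the partition obtained from $\lambda$ by removing $J$-removable nodes as long as possible. Parameters: $H_1,\dots,H_{l-1}\in\mathbb{Q}$, $H_0=-(H_1+\dots+H_{l-1})$, and $d$ a positive integer with $dH_i\in\mathbb{Z}$ for all $i$. Put $\theta=(1+H_0,H_1,\dots,H_{l-1})\in\mathbb{Q}^l_1:=\{(\theta_0,\dots,\theta_{l-1})\in\mathbb{Q}^l:\sum\theta_i=1\}$. Let $S_l$ be the group of permutations of $\{0,\dots,l-1\}$, generated by $s_1,\dots,s_{l-1}$ with $s_i$ the transposition of $i-1$ and $i$; it acts on $\mathbb{Q}^l$ by: $s_i\cdot\theta$ has entry $\theta_{i-1}+\theta_i$ in position $i-1$, $-\theta_i$ in position $i$, $\theta_i+\theta_{i+1}$ in position $i+1$, and is otherwise unchanged (indices mod $l$). Let $e_0,\dots,e_{l-1}$ be the standard basis of $\mathbb{Z}^l$, $R\subset\mathbb{Z}^l$ the lattice generated by $\alpha_i=-e_{i-1}+2e_i-e_{i+1}$ ($0\le i\le l-1$, indices mod $l$), and $\tilde{S}_l=R\rtimes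 S_l$, acting on $\mathbb{Q}^l_1$ with $R$ acting by translations. Let $\mathbb{Z}^l_0=\{\mathbf{r}\in\mathbb{Z}^l:\sum r_i=0\}$ and $\phi:\mathbb{Z}^l_0\to R$, $\phi(\mathbf{r})=\sum_{j}(r_{j-1}-r_j)e_j$ (indices mod $l$). Fix $w_\theta\in\tilde{S}_l$ such that $\boldsymbol{\epsilon}:=w_\theta\cdot\theta$ satisfies $0\le\varepsilon_i\le1$ for all $i$, and write $w_\theta=\phi(\mathbf{r})w$ with $\mathbf{r}=(r_0,\dots,r_{l-1})\in\mathbb{Z}^l_0$, $w\in S_l$. Let $J=\{j:\varepsilon_j=0\}$ (the type of $\theta$). Then $d\boldsymbol{\epsilon}\in\mathbb{Z}^l$. For $\mathbf{s}\in\mathbb{Z}^l$ with $s=\sum s_i$ and an $l$-multipartition $\boldsymbol{\lambda}$, $\tau_{\mathbf{s}}(\boldsymbol{\lambda})$ denotes the unique partition whose $s$-shifted $\beta$-number is the set $\chi(\beta^{s_0}(\lambda^{(0)}),\dots,\beta^{s_{l-1}}(\lambda^{(l-1)}))$ arranged in decreasing order. For $w\in S_l$, $w(\boldsymbol{\lambda})$ is the multipartition whose $p$-th component is $\lambda^{(w^{-1}(p))}$. *)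

theory Defs
  imports Main "HOL-Library.Countable"
begin

definition is_partition :: "nat list \<Rightarrow> bool" where
  "is_partition lm \<longleftrightarrow> sorted_wrt (\<ge>) lm \<and> (\<forall>x\<in>set lm. 0 < x)"

definition part_at :: "nat list \<Rightarrow> nat \<Rightarrow> nat" where
  "part_at lm i = (if 1 \<le> i \<and> i \<le> length lm then lm ! (i - 1) else 0)"

definition psize :: "nat list \<Rightarrow> nat" where
  "psize lm = sum_list lm"

definition young :: "nat list \<Rightarrow> (nat \<times> nat) set" where
  "young lm = {(a, b). 1 \<le> a \<and> 1 \<le> b \<and> b \<le> part_at lm a}"

definition content :: "nat \<times> nat \<Rightarrow> int" where
  "content node = int (snd node) - int (fst node)"

definition beta_set :: "int \<Rightarrow> nat list \<Rightarrow> int set" where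
  "beta_set r lm = {int (part_at lm i) + r + 1 - int i | i. 1 \<le> i}"

definition chi :: "nat \<Rightarrow> (nat \<Rightarrow> int set) \<Rightarrow> int set" where
  "chi l C = {int l * (c - 1) + int q + 1 | q c. q < l \<and> c \<in> C q}"

definition is_multipartition :: "nat \<Rightarrow> nat \<Rightarrow> nat list list \<Rightarrow> bool" where
  "is_multipartition l n lam \<longleftrightarrow> length lam = l \<and> (\<forall>p\<in>set lam. is_partition p)
     \<and> sum_list (map psize lam) = n"

definition tau :: "nat \<Rightarrow> (nat \<Rightarrow> int) \<Rightarrow> nat list list \<Rightarrow> nat list" where
  "tau l s lam = (THE \<nu>. is_partition \<nu> \<and>
      beta_set (\<Sum>q<l. s q) \<nu> = chi l (\<lambda>q. beta_set (s q) (lam ! q)))"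

definition removable :: "nat list \<Rightarrow> nat \<times> nat \<Rightarrow> bool" where
  "removable lm node \<longleftrightarrow> node \<in> young lm \<and>
     (\<exists>\<nu>. is_partition \<nu> \<and> young \<nu> = young lm - {node})"

definition J_removable :: "nat \<Rightarrow> nat set \<Rightarrow> nat list \<Rightarrow> nat \<times> nat \<Rightarrow> bool" where
  "J_removable l J lm node \<longleftrightarrow> removable lm node \<and>
     (\<exists>j\<in>J. content node mod int l = int j mod int l)"

definition J_remove_step :: "nat \<Rightarrow> nat set \<Rightarrow> nat list \<Rightarrow> nat list \<Rightarrow> bool" where
  "J_remove_step l J lm \<nu> \<longleftrightarrow> is_partition \<nu> \<and>
     (\<exists>node. J_removable l J lm node \<and> young \<nu> = young lm - {node})"

definition J_heart :: "nat \<Rightarrow> nat set \<Rightarrow> nat list \<Rightarrow> nat list" where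
  "J_heart l J lm = (THE \<nu>. (J_remove_step l J)\<^sup>*\<^sup>* lm \<nu> \<and> \<not> (\<exists>node. J_removable l J \<nu> node))"

text \<open>Vectors in Q^l / Z^l are functions on indices 0..l-1 (indices taken mod l).\<close>

definition alpha :: "nat \<Rightarrow> nat \<Rightarrow> nat \<Rightarrow> int" where
  "alpha l i j = (if j = i mod l then 2 else 0) - (if j = (i + l - 1) mod l then 1 else 0)
                 - (if j = (i + 1) mod l then 1 else 0)"

definition act_gen :: "nat \<Rightarrow> nat \<Rightarrow> (nat \<Rightarrow> rat) \<Rightarrow> (nat \<Rightarrow> rat)" where
  "act_gen l i \<theta> = (\<lambda>j. \<theta> j - \<theta> (i mod l) * of_int (alpha l i j))"

text \<open>A word [i1,...,ik] denotes s_{i1} ... s_{ik}.\<close>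
definition act_word :: "nat \<Rightarrow> nat list \<Rightarrow> (nat \<Rightarrow> rat) \<Rightarrow> (nat \<Rightarrow> rat)" where
  "act_word l ws \<theta> = foldr (act_gen l) ws \<theta>"

definition swap_nat :: "nat \<Rightarrow> nat \<Rightarrow> nat \<Rightarrow> nat" where
  "swap_nat a b x = (if x = a then b else if x = b then a else x)"

definition perm_word :: "nat list \<Rightarrow> nat \<Rightarrow> nat" where
  "perm_word ws = foldr (\<lambda>i f. swap_nat (i - 1) i \<circ> f) ws id"

definition phi :: "nat \<Rightarrow> (nat \<Rightarrow> int) \<Rightarrow> nat \<Rightarrow> int" where
  "phi l r j = r ((j + l - 1) mod l) - r j"

definition perm_multi :: "nat \<Rightarrow> (nat \<Rightarrow> nat) \<Rightarrow> nat list list \<Rightarrow> nat list list" where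
  "perm_multi l w lam = map (\<lambda>p. lam ! (inv w p)) [0..<l]"

definition theta :: "nat \<Rightarrow> (nat \<Rightarrow> rat) \<Rightarrow> nat \<Rightarrow> rat" where
  "theta l H j = (if j = 0 then 1 - (\<Sum>i\<in>{1..<l}. H i) else H j)"

section \<open>The Laurent polynomial sum_i x^{mbar_i} Res_{lam^(i)}(x^d)\<close>

text \<open>Represented by its coefficient function Z \<rightarrow> Z; mbar_i = d(H_1+...+H_i).\<close>
definition mbar :: "nat \<Rightarrow> (nat \<Rightarrow> rat) \<Rightarrow> nat \<Rightarrow> rat" where
  "mbar d H i = of_nat d * (\<Sum>j\<in>{1..i}. H j)"

definition res_coeff :: "nat \<Rightarrow> nat \<Rightarrow> (nat \<Rightarrow> rat) \<Rightarrow> nat list list \<Rightarrow> int \<Rightarrow> int" where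
  "res_coeff l d H lam k = int (card {(i, node). i < l \<and> node \<in> young (lam ! i) \<and>
      mbar d H i + of_int (int d * content node) = of_int k})"

end

theory Submission
  imports Defs
begin

text \<open>
  Put \<open>h i = H\<^sub>1 + \<dots> + H\<^sub>i\<close>. The generator \<open>s\<^sub>i\<close> acts on \<open>\<theta>\<close> by exchanging \<open>h (i - 1)\<close> and \<open>h i\<close>,
  so \<open>\<epsilon>\<close> is the vector of cyclic differences of \<open>g p = h (w\<inverse> p) - r p\<close>, and \<open>0 \<le> \<epsilon>\<close> says that
  \<open>g 0 \<le> \<dots> \<le> g (l - 1) \<le> g 0 + 1\<close>. Assign to the position \<open>l (b - 1) + q + 1\<close> of the
  abacus the level \<open>g q + b\<close>. The level is weakly increasing, and it is constant between \<open>x - 1\<close> and \<open>x\<close>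
  exactly when moving a bead from \<open>x\<close> to \<open>x - 1\<close> removes a node with residue in \<open>J\<close>. Hence the \<open>J\<close>-heart
  pushes all beads of each level to the left, and it is determined by the number of beads on each level.
  Finally, the generating function of these numbers is a constant plus \<open>(x - 1)\<close> times that of the
  numbers of nodes of \<open>\<lambda>\<^sup>(\<^sup>i\<^sup>)\<close> with \<open>h i + content\<close> prescribed, and \<open>x - 1\<close> is not a zero divisor.
\<close>

section \<open>Partitions and their beta-sets\<close>

lemma is_partition_Cons:
  "is_partition (k # \<nu>) \<longleftrightarrow> 0 < k \<and> (\<forall>x\<in>set \<nu>. x \<le> k) \<and> is_partition \<nu>"
  by (auto simp: is_partition_def)

lemma part_at_Cons: "part_at (k # \<nu>) (Suc i) = (if i = 0 then k else part_at \<nu> i)"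
  by (auto simp: part_at_def nth_Cons')

lemma part_at_antimono:
  assumes "is_partition \<nu>" "1 \<le> i" "i \<le> j"
  shows "part_at \<nu> j \<le> part_at \<nu> i"
  using assms
  by (cases "i = j") (auto simp: part_at_def is_partition_def sorted_wrt_iff_nth_less)

text \<open>Serves to build the diagram left after deleting a node, whose row lengths are prescribed
  as a function.\<close>

lemma partition_exists:
  assumes anti: "\<And>i j. 1 \<le> i \<Longrightarrow> i \<le> j \<Longrightarrow> f j \<le> f i" and fin: "f (Suc m) = (0::nat)"
  obtains \<nu> where "is_partition \<nu>" "\<And>i. 1 \<le> i \<Longrightarrow> part_at \<nu> i = f i"
proof -
  \<comment> \<open>Cutting at the first zero row keeps every listed part positive; monotonicity
    makes all later rows zero as well.\<close>
  define k where "k = (LEAST k. f (Suc k) = 0)"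
  have k0: "f (Suc k) = 0"
    unfolding k_def using fin by (rule LeastI)
  have pos: "0 < f (Suc i)" if "i < k" for i
    using not_less_Least[of i "\<lambda>k. f (Suc k) = 0"] that unfolding k_def by simp
  define \<nu> where "\<nu> = map (\<lambda>i. f (Suc i)) [0..<k]"
  have "is_partition \<nu>"
    unfolding is_partition_def \<nu>_def
    by (auto simp: sorted_wrt_iff_nth_less pos intro: anti)
  moreover have "part_at \<nu> i = f i" if "1 \<le> i" for i
  proof (cases "i \<le> k")
    case False
    then show ?thesis using that anti[of "Suc k" i] k0 by (simp add: part_at_def \<nu>_def)
  next
    case True
    moreover obtain i' where "i = Suc i'" using \<open>1 \<le> i\<close> by (cases i) auto
    ultimately show ?thesis by (simp add: part_at_def \<nu>_def)
  qed
  ultimately show ?thesis using that by blast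
qed

lemma young_Nil [simp]: "young [] = {}"
  by (auto simp: young_def part_at_def)

lemma young_Cons:
  "young (k # \<nu>) = (\<lambda>b. (1, b)) ` {1..k} \<union> (\<lambda>(a, b). (Suc a, b)) ` young \<nu>"
proof (intro set_eqI)
  fix x :: "nat \<times> nat"
  obtain a b where x: "x = (a, b)" by (cases x)
  show "x \<in> young (k # \<nu>) \<longleftrightarrow> x \<in> (\<lambda>b. (1, b)) ` {1..k} \<union> (\<lambda>(a, b). (Suc a, b)) ` young \<nu>"
    unfolding x by (cases a) (auto simp: young_def part_at_Cons image_iff)
qed

lemma finite_young [simp]: "finite (young \<nu>)"
  by (induction \<nu>) (simp_all add: young_Cons)

section \<open>Beta-sets: recursion over the rows and injectivity\<close>

lemma beta_set_eq_image: "beta_set s \<nu> = (\<lambda>i. int (part_at \<nu> i) + s + 1 - int i) ` {1..}"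
  by (auto simp: beta_set_def)

lemma inj_on_beta:
  assumes "is_partition \<nu>"
  shows "inj_on (\<lambda>i. int (part_at \<nu> i) + s + 1 - int i) {1..}"
proof (rule inj_onI)
  fix i j :: nat
  assume "i \<in> {1..}" "j \<in> {1..}"
    and "int (part_at \<nu> i) + s + 1 - int i = int (part_at \<nu> j) + s + 1 - int j"
  then show "i = j"
    using part_at_antimono[OF assms, of i j] part_at_antimono[OF assms, of j i]
    by (cases i j rule: linorder_cases) auto
qed

lemma beta_set_Nil: "beta_set s [] = {..s}"
proof -
  have "\<exists>i. x = s + 1 - int i \<and> 1 \<le> i" if "x \<le> s" for x
    using that by (intro exI[of _ "nat (s + 1 - x)"]) simp
  moreover have "beta_set s [] = {s + 1 - int i | i. 1 \<le> i}"
    by (simp add: beta_set_def part_at_def)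
  ultimately show ?thesis by auto
qed

text \<open>Dropping the first row shifts every index by one, which lowering the charge by one
  absorbs. This drives the inductions over the parts.\<close>

lemma beta_set_Cons: "beta_set s (k # \<nu>) = insert (int k + s) (beta_set (s - 1) \<nu>)"
proof -
  have "i \<in> {1..} \<longleftrightarrow> i \<in> insert 1 (Suc ` {1..})" for i
    by (cases i) (auto simp: image_iff)
  then have *: "{1..} = insert 1 (Suc ` {1..})" by blast
  have "beta_set s (k # \<nu>)
      = (\<lambda>i. int (part_at (k # \<nu>) i) + s + 1 - int i) ` insert (Suc 0) (Suc ` {1..})"
    unfolding beta_set_eq_image using * by simp
  also have "\<dots> = insert (int k + s) (beta_set (s - 1) \<nu>)"
    unfolding beta_set_eq_image image_insert image_image part_at_Cons
    by (intro arg_cong2[of _ _ _ _ insert] image_cong) auto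
  finally show ?thesis .
qed

lemma beta_set_le:
  assumes "is_partition \<nu>" "\<forall>x\<in>set \<nu>. x \<le> k" "x \<in> beta_set s \<nu>"
  shows "x \<le> int k + s"
  using assms
proof (induction \<nu> arbitrary: s)
  case (Cons a \<nu>)
  then show ?case using Cons.IH[of "s - 1"]
    by (force simp: beta_set_Cons is_partition_Cons)
qed (simp add: beta_set_Nil)

text \<open>The first part is read off the largest bead, because \<open>beta_set_le\<close> keeps
  the beads of the remaining rows strictly to its left.\<close>

lemma beta_set_inj:
  assumes "is_partition \<nu>" "is_partition \<nu>'" "beta_set s \<nu> = beta_set s \<nu>'"
  shows "\<nu> = \<nu>'"
  using assms
proof (induction \<nu> arbitrary: s \<nu>')
  case Nil
  show ?case
  proof (cases \<nu>')
    case (Cons k \<kappa>)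
    then have "int k + s \<in> {..s}" using Nil.prems by (simp add: beta_set_Nil beta_set_Cons)
    then show ?thesis using Nil.prems Cons by (simp add: is_partition_Cons)
  qed simp
next
  case (Cons k \<nu>)
  show ?case
  proof (cases \<nu>')
    case Nil
    then have "beta_set s (k # \<nu>) = {..s}" using Cons.prems(3) by (simp only: beta_set_Nil)
    then have "int k + s \<in> {..s}" unfolding beta_set_Cons by blast
    then show ?thesis using Cons.prems by (simp add: is_partition_Cons)
  next
    case (Cons k' \<kappa>)
    have less: "x < int k + s" if "x \<in> beta_set (s - 1) \<nu>" for x
      using beta_set_le[OF _ _ that, of k] Cons.prems(1) by (simp add: is_partition_Cons)
    have less': "x < int k' + s" if "x \<in> beta_set (s - 1) \<kappa>" for x
      using beta_set_le[OF _ _ that, of k'] Cons.prems(2) Cons by (simp add: is_partition_Cons)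
    have eq: "insert (int k + s) (beta_set (s - 1) \<nu>) = insert (int k' + s) (beta_set (s - 1) \<kappa>)"
      using Cons.prems(3) Cons by (simp add: beta_set_Cons)
    then have "int k + s \<le> int k' + s" "int k' + s \<le> int k + s"
      using less less' by (metis insertE insertI1 order.order_iff_strict)+
    then have k: "k = k'" by simp
    have "beta_set (s - 1) \<nu> = beta_set (s - 1) \<kappa>"
      using eq less less' unfolding k by (metis insert_ident less_irrefl)
    then show ?thesis using Cons.IH Cons.prems Cons k by (simp add: is_partition_Cons)
  qed
qed

section \<open>Bead sets of a given charge\<close>

text \<open>The integer \<open>m\<close> is any cutoff below which \<open>X\<close> has no gaps; \<open>s\<close> is the charge.\<close>

definition charged :: "int \<Rightarrow> int \<Rightarrow> int set \<Rightarrow> bool" where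
  "charged s m X \<longleftrightarrow> {..m} \<subseteq> X \<and> finite (X \<inter> {m<..}) \<and> int (card (X \<inter> {m<..})) = s - m"

lemma charged_beta_set:
  assumes "is_partition \<nu>" "m \<le> s - int (length \<nu>)"
  shows "charged s m (beta_set s \<nu>)"
  using assms
proof (induction \<nu> arbitrary: s)
  case Nil
  have "{..s} \<inter> {m<..} = {m<..s}" by auto
  then show ?case using Nil by (simp add: charged_def beta_set_Nil)
next
  case (Cons k \<nu>)
  have IH: "charged (s - 1) m (beta_set (s - 1) \<nu>)"
    using Cons by (simp add: is_partition_Cons)
  have "int k + s \<notin> beta_set (s - 1) \<nu>"
    using beta_set_le[of \<nu> k "int k + s" "s - 1"] Cons.prems(1) by (auto simp: is_partition_Cons)
  moreover have "insert (int k + s) (beta_set (s - 1) \<nu>) \<inter> {m<..}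
      = insert (int k + s) (beta_set (s - 1) \<nu> \<inter> {m<..})"
    using Cons.prems(2) by auto
  ultimately show ?case using IH by (auto simp: charged_def beta_set_Cons)
qed

text \<open>Induction on the number of beads beyond \<open>m\<close>: the largest bead
  \<open>x\<close> becomes a first row of length \<open>x - s\<close>, and the other beads have
  charge \<open>s - 1\<close>.\<close>

lemma charged_imp_beta_set:
  assumes "charged s m X"
  shows "\<exists>\<nu>. is_partition \<nu> \<and> beta_set s \<nu> = X"
  using assms
proof (induction "nat (s - m)" arbitrary: s X)
  case 0
  have "int (card (X \<inter> {m<..})) = s - m" "finite (X \<inter> {m<..})" "{..m} \<subseteq> X"
    using 0 by (simp_all add: charged_def)
  moreover from this have "card (X \<inter> {m<..}) = 0" "s = m" using 0 by linarith+
  ultimately have "X \<inter> {m<..} = {}" "s = m" "{..m} \<subseteq> X" by simp_all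
  then have "X = {..s}" by fastforce
  then show ?case by (intro exI[of _ "[]"]) (simp add: is_partition_def beta_set_Nil)
next
  case (Suc n)
  let ?F = "X \<inter> {m<..}"
  define x where "x = Max ?F"
  have fin: "finite ?F" and card: "int (card ?F) = s - m" and sub: "{..m} \<subseteq> X"
    using Suc.prems by (auto simp: charged_def)
  have "?F \<noteq> {}" using card Suc.hyps(2) by (metis card.empty diff_0_right int_ops(1) nat_0 nat.simps(3))
  then have x: "x \<in> X" "m < x" and max: "\<And>y. y \<in> X \<Longrightarrow> y \<le> x"
    using Max_in[OF fin] Max_ge[OF fin] unfolding x_def by (auto, meson not_le order_trans less_imp_le)
  have F': "(X - {x}) \<inter> {m<..} = ?F - {x}" by auto
  have "Suc (card (?F - {x})) = card ?F" using fin x by (intro card_Suc_Diff1) auto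
  then have "charged (s - 1) m (X - {x})"
    using fin card sub x unfolding charged_def F' by auto
  moreover have "n = nat (s - 1 - m)" using Suc.hyps(2) by linarith
  ultimately obtain \<nu> where \<nu>: "is_partition \<nu>" "beta_set (s - 1) \<nu> = X - {x}"
    using Suc.hyps(1) by blast
  \<comment> \<open>The \<open>s - m\<close> beads beyond \<open>m\<close> fit between
    \<open>m\<close> and \<open>x\<close>, so \<open>x\<close> is not left of \<open>s\<close> and
    \<open>x - s\<close> is a possible row length.\<close>
  have "?F \<subseteq> {m<..x}" using max by auto
  then have "card ?F \<le> card {m<..x}" by (intro card_mono) auto
  then have xs: "s \<le> x" using card x by auto
  have hd: "int (hd \<nu>) + s - 1 < x" if "\<nu> \<noteq> []"
  proof -
    obtain k \<kappa> where k: "\<nu> = k # \<kappa>" using \<open>\<nu> \<noteq> []\<close> by (cases \<nu>) auto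
    have "int k + (s - 1) \<in> X - {x}" unfolding \<nu>(2)[symmetric] k by (simp add: beta_set_Cons)
    then have "int k + (s - 1) < x" using max[of "int k + (s - 1)"] by auto
    then show ?thesis using k by simp
  qed
  show ?case
  \<comment> \<open>A first row of length 0 may not be listed; in this case all rows vanish.\<close>
  proof (cases "x = s")
    case True
    have "\<nu> = []" using hd True \<nu>(1) by (cases \<nu>) (auto simp: is_partition_Cons)
    then have "X - {s} = {..s - 1}" using \<nu>(2) True by (simp add: beta_set_Nil)
    moreover have "insert s {..s - 1} = {..s}" by auto
    ultimately have "X = {..s}" using x(1) True by (metis insert_Diff)
    then show ?thesis by (intro exI[of _ "[]"]) (simp add: is_partition_def beta_set_Nil)
  next
    case False
    have "is_partition (nat (x - s) # \<nu>)"
      using \<nu>(1) hd xs False by (cases \<nu>) (auto simp: is_partition_Cons)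
    moreover have "beta_set s (nat (x - s) # \<nu>) = X"
      using \<nu>(2) x(1) xs by (simp add: beta_set_Cons insert_absorb)
    ultimately show ?thesis by blast
  qed
qed

section \<open>Removing a node moves a bead\<close>

lemma young_eq_imp_part_at_eq:
  assumes "young \<nu> \<inter> ({a} \<times> UNIV) = young \<kappa> \<inter> ({a} \<times> UNIV)" "1 \<le> a"
  shows "part_at \<nu> a = part_at \<kappa> a"
proof -
  have "1 \<le> b \<and> b \<le> part_at \<nu> a \<longleftrightarrow> 1 \<le> b \<and> b \<le> part_at \<kappa> a" for b
    using assms by (auto simp: young_def set_eq_iff)
  from this[of "part_at \<nu> a"] this[of "part_at \<kappa> a"] show ?thesis by linarith
qed

lemma remove_node_part_at:
  assumes "(a, b) \<in> young \<nu>" "young \<nu>' = young \<nu> - {(a, b)}"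
  shows "1 \<le> a" "0 < part_at \<nu> a" "b = part_at \<nu> a" "part_at \<nu>' a = part_at \<nu> a - 1"
    "\<And>i. 1 \<le> i \<Longrightarrow> i \<noteq> a \<Longrightarrow> part_at \<nu>' i = part_at \<nu> i"
proof -
  show a: "1 \<le> a" and "0 < part_at \<nu> a" using assms(1) by (auto simp: young_def)
  have *: "1 \<le> c \<and> c \<le> part_at \<nu>' a \<longleftrightarrow> 1 \<le> c \<and> c \<le> part_at \<nu> a \<and> c \<noteq> b" for c
    using assms(2) a by (auto simp: young_def set_eq_iff)
  have b: "1 \<le> b" "b \<le> part_at \<nu> a" using assms(1) by (auto simp: young_def)
  \<comment> \<open>A row of \<open>\<nu>'\<close> has no holes, so the deleted node can only be the
    last one of its row.\<close>
  show b': "b = part_at \<nu> a"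
    using *[of b] *[of "part_at \<nu> a"] b by linarith
  show "part_at \<nu>' a = part_at \<nu> a - 1"
    using *[of "part_at \<nu> a - 1"] *[of "part_at \<nu>' a"] *[of "part_at \<nu> a"] b b' by linarith
  show "part_at \<nu>' i = part_at \<nu> i" if "1 \<le> i" "i \<noteq> a" for i
    by (rule young_eq_imp_part_at_eq) (use assms that in auto)
qed

text \<open>In charge \<open>s\<close> the bead of a row sits at the content of the last node of the
  row plus \<open>s + 1\<close>, so deleting that node moves this bead one place to the
  left.\<close>

lemma remove_node_beta_set:
  assumes "is_partition \<nu>" "is_partition \<nu>'" "p \<in> young \<nu>" "young \<nu>' = young \<nu> - {p}"
    and x_def: "x = content p + s + 1"
  shows "x \<in> beta_set s \<nu>" "x - 1 \<notin> beta_set s \<nu>"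
    "beta_set s \<nu>' = insert (x - 1) (beta_set s \<nu> - {x})"
proof -
  obtain a b where p: "p = (a, b)" by (cases p) auto
  note rem = remove_node_part_at[OF assms(3,4)[unfolded p]]
  let ?f = "\<lambda>\<nu> i. int (part_at \<nu> i) + s + 1 - int i"
  have x: "x = ?f \<nu> a" and x': "x - 1 = ?f \<nu>' a"
    using rem by (auto simp: x_def p content_def)
  have "{1..} = insert a ({1..} - {a})" using rem(1) by auto
  then have split: "?f \<kappa> ` {1..} = insert (?f \<kappa> a) (?f \<kappa> ` ({1..} - {a}))" for \<kappa>
    by (metis (no_types, lifting) image_insert)
  have same: "?f \<nu>' ` ({1..} - {a}) = ?f \<nu> ` ({1..} - {a})"
    by (rule image_cong) (use rem(5) in auto)
  \<comment> \<open>For \<open>\<nu>\<close> this keeps the other beads away from \<open>x\<close>;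
    for \<open>\<nu>'\<close> it keeps them away from \<open>x - 1\<close>, so the target place was
    free.\<close>
  have notin: "?f \<kappa> a \<notin> ?f \<kappa> ` ({1..} - {a})" if "is_partition \<kappa>" for \<kappa>
    using inj_on_beta[OF that, of s] rem(1) by (auto dest!: inj_onD)
  define S where "S = ?f \<nu> ` ({1..} - {a})"
  have \<nu>: "beta_set s \<nu> = insert x S"
    unfolding beta_set_eq_image x S_def by (rule split)
  have \<nu>': "beta_set s \<nu>' = insert (x - 1) S"
    unfolding beta_set_eq_image x' S_def same[symmetric] by (rule split)
  have "x \<notin> S"
    using notin[OF assms(1)] unfolding x S_def .
  moreover have "x - 1 \<notin> S"
    using notin[OF assms(2)] unfolding x' S_def same .
  ultimately show "x \<in> beta_set s \<nu>" "x - 1 \<notin> beta_set s \<nu>"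
    "beta_set s \<nu>' = insert (x - 1) (beta_set s \<nu> - {x})"
    unfolding \<nu> \<nu>' by auto
qed

text \<open>Converse direction: a free place left of the bead of row \<open>a\<close> means that row
  \<open>Suc a\<close> is strictly shorter, so the last node of row \<open>a\<close> can go.\<close>

lemma remove_node_exists:
  assumes part: "is_partition \<nu>" and x: "x \<in> beta_set s \<nu>" "x - 1 \<notin> beta_set s \<nu>"
  obtains p \<nu>' where "p \<in> young \<nu>" "content p = x - s - 1" "is_partition \<nu>'" "young \<nu>' = young \<nu> - {p}"
proof -
  obtain a where a: "1 \<le> a" "x = int (part_at \<nu> a) + s + 1 - int a"
    using x(1) by (auto simp: beta_set_def)
  have "x - 1 \<noteq> int (part_at \<nu> (Suc a)) + s + 1 - int (Suc a)"
    using x(2) unfolding beta_set_def by (metis (mono_tags, lifting) le_add1 mem_Collect_eq plus_1_eq_Suc)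
  then have less: "part_at \<nu> (Suc a) < part_at \<nu> a"
    using part_at_antimono[OF part, of a "Suc a"] a by auto
  define f where "f = (part_at \<nu>)(a := part_at \<nu> a - 1)"
  \<comment> \<open>Only comparing the shortened row \<open>a\<close> with a later row needs the
    strict inequality.\<close>
  have "f j \<le> f i" if "1 \<le> i" "i \<le> j" for i j
  proof (cases "i = a \<and> j \<noteq> a")
    case True
    then show ?thesis
      using part_at_antimono[OF part, of "Suc a" j] less that by (auto simp: f_def)
  next
    case False
    then show ?thesis
      using part_at_antimono[OF part, of i j] that by (auto simp: f_def)
  qed
  moreover have "f (Suc (a + length \<nu>)) = 0" by (simp add: f_def part_at_def)
  ultimately obtain \<nu>' where \<nu>': "is_partition \<nu>'" "\<And>i. 1 \<le> i \<Longrightarrow> part_at \<nu>' i = f i"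
    using partition_exists[of f] by metis
  show ?thesis
  proof
    show "(a, part_at \<nu> a) \<in> young \<nu>" using less a by (auto simp: young_def)
    show "content (a, part_at \<nu> a) = x - s - 1" using a by (simp add: content_def)
    show "young \<nu>' = young \<nu> - {(a, part_at \<nu> a)}"
      using \<nu>'(2) less by (auto simp: young_def f_def split: if_splits)
  qed (fact \<nu>'(1))
qed

section \<open>Hearts and bead counts per level\<close>

definition bead_count :: "(int \<Rightarrow> 'a) \<Rightarrow> int set \<Rightarrow> 'a \<Rightarrow> nat" where
  "bead_count G X v = card {x \<in> X. G x = v}"

text \<open>In charge 0 a row whose last node has content \<open>c\<close> has its bead at
  \<open>c + 1\<close>; hence the residue of \<open>x - 1\<close> and not of \<open>x\<close>.
  Finite levels make the cardinalities in \<open>bead_count\<close> meaningful.\<close>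

locale level =
  fixes l :: nat and J :: "nat set" and G :: "int \<Rightarrow> 'a::linorder"
  assumes level_mono: "G (x - 1) \<le> G x"
    and level_eq_iff: "G (x - 1) = G x \<longleftrightarrow> (\<exists>j\<in>J. (x - 1) mod int l = int j mod int l)"
    and finite_level: "finite {x. G x = v}"
begin

lemma mono_level: "x \<le> y \<Longrightarrow> G x \<le> G y"
proof (induction y rule: int_ge_induct)
  case (step y)
  then show ?case using level_mono[of "y + 1"] by (auto intro: order_trans)
qed simp

lemma J_remove_step_bead_count:
  assumes "is_partition \<nu>" "J_remove_step l J \<nu> \<nu>'"
  shows "bead_count G (beta_set 0 \<nu>') = bead_count G (beta_set 0 \<nu>)"
proof
  fix v
  obtain p where p: "is_partition \<nu>'" "J_removable l J \<nu> p" "young \<nu>' = young \<nu> - {p}"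
    using assms(2) by (auto simp: J_remove_step_def)
  have py: "p \<in> young \<nu>" using p(2) by (simp add: J_removable_def removable_def)
  define x where "x = content p + 1"
  have x: "x \<in> beta_set 0 \<nu>" "x - 1 \<notin> beta_set 0 \<nu>"
    "beta_set 0 \<nu>' = insert (x - 1) (beta_set 0 \<nu> - {x})"
    using remove_node_beta_set[OF assms(1) p(1) py p(3), of x 0] by (simp_all add: x_def)
  have G: "G (x - 1) = G x"
    using p(2) unfolding level_eq_iff by (simp add: J_removable_def x_def)
  have fin: "finite {x \<in> beta_set 0 \<nu>. G x = v}"
    using finite_level[of v] by (rule rev_finite_subset) auto
  show "bead_count G (beta_set 0 \<nu>') v = bead_count G (beta_set 0 \<nu>) v"
  proof (cases "G x = v")
    case True
    let ?A = "{y \<in> beta_set 0 \<nu>. G y = v}"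
    have "{y \<in> beta_set 0 \<nu>'. G y = v} = insert (x - 1) (?A - {x})"
      unfolding x(3) using G True by auto
    moreover have "card (insert (x - 1) (?A - {x})) = Suc (card (?A - {x}))"
      using fin x(2) by (intro card_insert_disjoint) auto
    moreover have "Suc (card (?A - {x})) = card ?A"
      using fin x(1) True by (intro card_Suc_Diff1) auto
    ultimately show ?thesis by (simp only: bead_count_def)
  next
    case False
    have "{y \<in> beta_set 0 \<nu>'. G y = v} = {y \<in> beta_set 0 \<nu>. G y = v}"
      unfolding x(3) using G False by auto
    then show ?thesis by (simp add: bead_count_def)
  qed
qed

lemma J_remove_steps_bead_count:
  assumes "(J_remove_step l J)\<^sup>*\<^sup>* \<nu> \<nu>'" "is_partition \<nu>"
  shows "is_partition \<nu>' \<and> bead_count G (beta_set 0 \<nu>') = bead_count G (beta_set 0 \<nu>)"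
  using assms
proof (induction rule: rtranclp_induct)
  case (step \<kappa> \<kappa>')
  then show ?case using J_remove_step_bead_count[of \<kappa> \<kappa>'] by (simp add: J_remove_step_def)
qed simp

text \<open>Removal terminates because the diagram loses a node each time.\<close>

lemma J_heart_exists:
  assumes "is_partition \<nu>"
  shows "\<exists>\<kappa>. (J_remove_step l J)\<^sup>*\<^sup>* \<nu> \<kappa> \<and> \<not> (\<exists>p. J_removable l J \<kappa> p)"
  using assms
proof (induction "card (young \<nu>)" arbitrary: \<nu> rule: less_induct)
  case less
  show ?case
  proof (cases "\<exists>p. J_removable l J \<nu> p")
    case True
    then obtain p \<kappa> where p: "J_removable l J \<nu> p" "p \<in> young \<nu>" "is_partition \<kappa>" "young \<kappa> = young \<nu> - {p}"
      by (auto simp: J_removable_def removable_def)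
    then have "card (young \<kappa>) < card (young \<nu>)" by (metis card_Diff1_less finite_young)
    moreover have "J_remove_step l J \<nu> \<kappa>" using p unfolding J_remove_step_def by blast
    ultimately show ?thesis using less.hyps[of \<kappa>] p(3) by (meson converse_rtranclp_into_rtranclp)
  qed blast
qed

text \<open>A gap to the left of \<open>x\<close> within its level would leave some bead with a free
  left neighbour on the same level, that is, a \<open>J\<close>-removable node.\<close>

lemma heart_left_closed:
  assumes "is_partition \<nu>" "\<not> (\<exists>p. J_removable l J \<nu> p)"
    and "x \<in> beta_set 0 \<nu>" "y \<le> x" "G y = G x"
  shows "y \<in> beta_set 0 \<nu>"
  using assms(4,5)
proof (induction y rule: int_le_induct)
  case base
  show ?case by fact
next
  case (step y)
  \<comment> \<open>Monotonicity squeezes \<open>G y\<close> between the equal values at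
    \<open>y - 1\<close> and \<open>x\<close>.\<close>
  have "G (y - 1) = G y"
    using step level_mono[of y] mono_level[of y x] by auto
  then have res: "\<exists>j\<in>J. (y - 1) mod int l = int j mod int l" and "G y = G x"
    using step by (simp_all add: level_eq_iff)
  show ?case
  proof (rule ccontr)
    assume "y - 1 \<notin> beta_set 0 \<nu>"
    then obtain p \<nu>' where "p \<in> young \<nu>" "content p = y - 0 - 1"
      "is_partition \<nu>'" "young \<nu>' = young \<nu> - {p}"
      using remove_node_exists[OF assms(1)] step.IH \<open>G y = G x\<close> by metis
    then have "J_removable l J \<nu> p" using res unfolding J_removable_def removable_def by auto
    then show False using assms(2) by blast
  qed
qed

text \<open>On each level the beads of a heart form an initial segment, so two hearts compare by
  inclusion there. A missing bead makes the inclusion strict, and the counts differ.\<close>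

lemma heart_subset:
  assumes "is_partition \<nu>" "\<not> (\<exists>p. J_removable l J \<nu> p)"
    and "is_partition \<nu>'" "\<not> (\<exists>p. J_removable l J \<nu>' p)"
    and "bead_count G (beta_set 0 \<nu>) = bead_count G (beta_set 0 \<nu>')"
  shows "beta_set 0 \<nu> \<subseteq> beta_set 0 \<nu>'"
proof (rule subsetI, rule ccontr)
  fix x assume x: "x \<in> beta_set 0 \<nu>" "x \<notin> beta_set 0 \<nu>'"
  let ?A = "{y \<in> beta_set 0 \<nu>. G y = G x}" and ?B = "{y \<in> beta_set 0 \<nu>'. G y = G x}"
  have "y < x" if "y \<in> ?B" for y
    using heart_left_closed[OF assms(3,4), of y x] that x by force
  then have "?B \<subseteq> ?A" using heart_left_closed[OF assms(1,2) x(1)] by (auto intro: less_imp_le)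
  then have "?B \<subset> ?A" using x by auto
  moreover have "finite ?A" using finite_level[of "G x"] by (rule rev_finite_subset) auto
  ultimately have "card ?B < card ?A" by (simp add: psubset_card_mono)
  then show False using fun_cong[OF assms(5), of "G x"] by (simp add: bead_count_def)
qed

lemma heart_unique:
  assumes "is_partition \<nu>" "\<not> (\<exists>p. J_removable l J \<nu> p)"
    and "is_partition \<nu>'" "\<not> (\<exists>p. J_removable l J \<nu>' p)"
    and "bead_count G (beta_set 0 \<nu>) = bead_count G (beta_set 0 \<nu>')"
  shows "\<nu> = \<nu>'"
  using heart_subset[OF assms] heart_subset[OF assms(3,4,1,2) assms(5)[symmetric]]
    beta_set_inj[OF assms(1,3)] by blast

lemma J_heart_props:
  assumes "is_partition \<nu>"
  shows "is_partition (J_heart l J \<nu>)" "\<not> (\<exists>p. J_removable l J (J_heart l J \<nu>) p)"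
    "bead_count G (beta_set 0 (J_heart l J \<nu>)) = bead_count G (beta_set 0 \<nu>)"
proof -
  let ?P = "\<lambda>\<kappa>. (J_remove_step l J)\<^sup>*\<^sup>* \<nu> \<kappa> \<and> \<not> (\<exists>p. J_removable l J \<kappa> p)"
  \<comment> \<open>Uniqueness of the end result comes from the invariance of the bead counts, in
    place of a confluence argument.\<close>
  have "\<exists>!\<kappa>. ?P \<kappa>"
  proof (rule ex_ex1I)
    show "\<exists>\<kappa>. ?P \<kappa>" by (rule J_heart_exists[OF assms])
  next
    fix \<kappa> \<kappa>' assume \<kappa>: "?P \<kappa>" "?P \<kappa>'"
    then show "\<kappa> = \<kappa>'"
      using J_remove_steps_bead_count[OF _ assms, of \<kappa>] J_remove_steps_bead_count[OF _ assms, of \<kappa>']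
      by (intro heart_unique) simp_all
  qed
  then have "?P (J_heart l J \<nu>)" unfolding J_heart_def by (rule theI')
  then show "is_partition (J_heart l J \<nu>)" "\<not> (\<exists>p. J_removable l J (J_heart l J \<nu>) p)"
    "bead_count G (beta_set 0 (J_heart l J \<nu>)) = bead_count G (beta_set 0 \<nu>)"
    using J_remove_steps_bead_count[OF _ assms] by blast+
qed

lemma J_heart_eq_iff:
  assumes "is_partition \<nu>" "is_partition \<nu>'"
  shows "J_heart l J \<nu> = J_heart l J \<nu>' \<longleftrightarrow>
    bead_count G (beta_set 0 \<nu>) = bead_count G (beta_set 0 \<nu>')"
  using J_heart_props[OF assms(1)] J_heart_props[OF assms(2)] heart_unique by metis

end

section \<open>The abacus\<close>

lemma chi_position:
  assumes "q < l"
  shows "(int l * (b - 1) + int q + 1 - 1) mod int l = int q"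
    "(int l * (b - 1) + int q + 1 - 1) div int l = b - 1"
  using assms by (simp_all add: zdiv_int)

lemma inj_on_chi_position:
  "inj_on (\<lambda>(q, b). int l * (b - 1) + int q + 1) ({..<l} \<times> UNIV)"
proof (rule inj_onI)
  fix x y :: "nat \<times> int"
  assume xy: "x \<in> {..<l} \<times> UNIV" "y \<in> {..<l} \<times> UNIV"
    and eq: "(case x of (q, b) \<Rightarrow> int l * (b - 1) + int q + 1)
      = (case y of (q, b) \<Rightarrow> int l * (b - 1) + int q + 1)"
  obtain q b q' b' where x: "x = (q, b)" "y = (q', b')" by (metis surj_pair)
  have q: "q < l" "q' < l" and eq: "int l * (b - 1) + int q + 1 = int l * (b' - 1) + int q' + 1"
    using xy eq by (auto simp: x)
  have "int q = int q'" "b - 1 = b' - 1"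
    using chi_position[OF q(1), of b] chi_position[OF q(2), of b'] unfolding eq by simp_all
  then show "x = y" by (simp add: x)
qed

text \<open>Bead \<open>b\<close> of runner \<open>q\<close> passes the cutoff \<open>l * m\<close>
  on the abacus exactly when \<open>b\<close> passes \<open>m\<close>, so the numbers of beads
  beyond the cutoffs add up.\<close>

lemma charged_chi:
  assumes "0 < l" and C: "\<And>q. q < l \<Longrightarrow> charged (s q) m (C q)"
  shows "charged (\<Sum>q<l. s q) (int l * m) (chi l C)"
proof -
  let ?pos = "\<lambda>(q, b). int l * (b - 1) + int q + 1"
  let ?S = "SIGMA q:{..<l}. C q \<inter> {m<..}"
  have inj: "inj_on ?pos ({..<l} \<times> UNIV)"
    by (rule inj_on_chi_position)
  have gt: "int l * m < int l * (b - 1) + int q + 1 \<longleftrightarrow> m < b" if "q < l" for q and b :: int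
  proof
    assume "m < b"
    then have "int l * m \<le> int l * (b - 1)" by (intro mult_left_mono) auto
    then show "int l * m < int l * (b - 1) + int q + 1" by linarith
  next
    assume less: "int l * m < int l * (b - 1) + int q + 1"
    show "m < b"
    proof (rule ccontr)
      assume "\<not> m < b"
      then have "int l * b \<le> int l * m" by (intro mult_left_mono) auto
      moreover have "int l * (b - 1) = int l * b - int l" by (simp add: algebra_simps)
      ultimately show False using less that by linarith
    qed
  qed
  have chi: "chi l C = ?pos ` (SIGMA q:{..<l}. C q)"
    by (auto simp: chi_def image_iff Bex_def)
  have eq: "chi l C \<inter> {int l * m<..} = ?pos ` ?S"
    unfolding chi using gt by (intro set_eqI iffI; clarsimp simp: image_iff Bex_def) blast+
  have fin: "finite ?S"
    using C by (intro finite_SigmaI) (auto simp: charged_def)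
  have "card (?pos ` ?S) = card ?S"
    by (intro card_image inj_on_subset[OF inj]) auto
  also have "\<dots> = (\<Sum>q<l. card (C q \<inter> {m<..}))"
    using C by (intro card_SigmaI) (auto simp: charged_def)
  finally have "int (card (?pos ` ?S)) = (\<Sum>q<l. s q - m)"
    using C by (simp add: charged_def)
  moreover have "{..int l * m} \<subseteq> chi l C"
  proof
    fix x assume "x \<in> {..int l * m}"
    define q where "q = nat ((x - 1) mod int l)"
    define b where "b = (x - 1) div int l + 1"
    have q: "q < l" using \<open>0 < l\<close> by (simp add: q_def nat_less_iff)
    have x: "x = int l * (b - 1) + int q + 1"
      using \<open>0 < l\<close> by (simp add: q_def b_def)
    then have "b \<le> m" using gt[OF q, of b] \<open>x \<in> _\<close> by auto
    then have "b \<in> C q" using C[OF q] by (auto simp: charged_def)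
    then show "x \<in> chi l C" using x q by (auto simp: chi_def)
  qed
  ultimately show ?thesis
    using fin by (simp add: charged_def eq sum_subtractf)
qed

lemma tau_props:
  assumes "0 < l" "\<And>q. q < l \<Longrightarrow> is_partition (lam ! q)" "(\<Sum>q<l. s q) = 0"
  shows "is_partition (tau l s lam)"
    "beta_set 0 (tau l s lam) = chi l (\<lambda>q. beta_set (s q) (lam ! q))"
proof -
  let ?X = "chi l (\<lambda>q. beta_set (s q) (lam ! q))"
  \<comment> \<open>One cutoff that serves all components at once.\<close>
  define m where "m = Min (insert 0 ((\<lambda>q. s q - int (length (lam ! q))) ` {..<l}))"
  have "charged (s q) m (beta_set (s q) (lam ! q))" if "q < l" for q
    using that assms(2) by (intro charged_beta_set) (auto simp: m_def)
  then have "charged (\<Sum>q<l. s q) (int l * m) ?X" using charged_chi[OF assms(1)] by simp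
  \<comment> \<open>Justifies the definite description in \<open>tau\<close>: existence from the
    charge, uniqueness from \<open>beta_set_inj\<close>.\<close>
  then have "\<exists>!\<nu>. is_partition \<nu> \<and> beta_set (\<Sum>q<l. s q) \<nu> = ?X"
    using charged_imp_beta_set by (blast intro: beta_set_inj)
  then have "is_partition (tau l s lam) \<and> beta_set (\<Sum>q<l. s q) (tau l s lam) = ?X"
    unfolding tau_def by (rule theI')
  then show "is_partition (tau l s lam)" "beta_set 0 (tau l s lam) = ?X"
    using assms(3) by simp_all
qed

section \<open>Levels of abacus positions\<close>

definition abacus_level :: "nat \<Rightarrow> (nat \<Rightarrow> rat) \<Rightarrow> int \<Rightarrow> rat" where
  "abacus_level l g x = g (nat ((x - 1) mod int l)) + of_int ((x - 1) div int l + 1)"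

lemma abacus_level_position:
  "q < l \<Longrightarrow> abacus_level l g (int l * (b - 1) + int q + 1) = g q + of_int b"
  unfolding abacus_level_def by (simp only: chi_position) simp

text \<open>Coordinates of the point with partial sums \<open>h\<close>; the 1 in position 0 makes
  them add up to 1.\<close>

definition cyclic_diff :: "nat \<Rightarrow> (nat \<Rightarrow> rat) \<Rightarrow> nat \<Rightarrow> rat" where
  "cyclic_diff l h j = (if j = 0 then 1 + h 0 - h (l - 1) else h j - h (j - 1))"

text \<open>One place to the left is the preceding runner with the same \<open>b\<close>, or, from
  runner 0, the last runner with \<open>b - 1\<close>; this loss is the 1 in
  \<open>cyclic_diff\<close>.\<close>

lemma abacus_level_diff:
  assumes "0 < l"
  shows "abacus_level l g x - abacus_level l g (x - 1) = cyclic_diff l g (nat ((x - 1) mod int l))"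
proof -
  define q where "q = nat ((x - 1) mod int l)"
  define b where "b = (x - 1) div int l + 1"
  have q: "q < l" using assms by (simp add: q_def nat_less_iff)
  have x: "x = int l * (b - 1) + int q + 1"
    using assms by (simp add: q_def b_def)
  have L: "abacus_level l g x = g q + of_int b"
    unfolding x using q by (rule abacus_level_position)
  show ?thesis
  proof (cases "q = 0")
    case True
    have "x - 1 = int l * ((b - 1) - 1) + int (l - 1) + 1"
      using x True assms by (simp add: algebra_simps of_nat_diff)
    then have "abacus_level l g (x - 1) = g (l - 1) + of_int (b - 1)"
      using abacus_level_position[of "l - 1" l g "b - 1"] assms by simp
    then show ?thesis using L True by (simp add: cyclic_diff_def flip: q_def)
  next
    case False
    have "x - 1 = int l * (b - 1) + int (q - 1) + 1"
      using x False by simp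
    then have "abacus_level l g (x - 1) = g (q - 1) + of_int b"
      using abacus_level_position[of "q - 1" l g b] q by (metis less_imp_diff_less)
    then show ?thesis using L False by (simp add: cyclic_diff_def flip: q_def)
  qed
qed

text \<open>A level meets each of the \<open>l\<close> runners at most once.\<close>

lemma finite_abacus_level:
  assumes "0 < l"
  shows "finite {x. abacus_level l g x = v}"
proof -
  let ?S = "{x. abacus_level l g x = v}"
  have "inj_on (\<lambda>x. (x - 1) mod int l) ?S"
  proof (rule inj_onI)
    fix x y assume "x \<in> ?S" "y \<in> ?S" and m: "(x - 1) mod int l = (y - 1) mod int l"
    then have "(x - 1) div int l = (y - 1) div int l"
      by (auto simp: abacus_level_def)
    then have "x - 1 = y - 1" using m by (metis div_mult_mod_eq)
    then show "x = y" by simp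
  qed
  moreover have "(\<lambda>x. (x - 1) mod int l) ` ?S \<subseteq> {0..<int l}" using assms by auto
  ultimately show ?thesis by (meson finite_atLeastLessThan_int finite_imageD finite_subset)
qed

lemma level_abacus_level:
  assumes "0 < l" "\<And>j. j < l \<Longrightarrow> 0 \<le> cyclic_diff l g j" "J = {j. j < l \<and> cyclic_diff l g j = 0}"
  shows "level l J (abacus_level l g)"
proof
  fix x
  define q where "q = nat ((x - 1) mod int l)"
  have q: "q < l" "(x - 1) mod int l = int q"
    using assms(1) by (simp_all add: q_def nat_less_iff)
  note diff = abacus_level_diff[OF assms(1), of g x, folded q_def]
  show "abacus_level l g (x - 1) \<le> abacus_level l g x"
    using diff assms(2)[OF q(1)] by linarith
  have "abacus_level l g (x - 1) = abacus_level l g x \<longleftrightarrow> q \<in> J"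
    using diff q(1) assms(3) by auto
  also have "\<dots> \<longleftrightarrow> (\<exists>j\<in>J. (x - 1) mod int l = int j mod int l)"
    using q assms(3) by (auto simp flip: zmod_int)
  finally show "abacus_level l g (x - 1) = abacus_level l g x \<longleftrightarrow>
    (\<exists>j\<in>J. (x - 1) mod int l = int j mod int l)" .
qed (rule finite_abacus_level[OF assms(1)])

lemma bead_count_chi:
  "bead_count (abacus_level l g) (chi l C) v = (\<Sum>q<l. card {b \<in> C q. of_int b = v - g q})"
proof -
  let ?pos = "\<lambda>(q, b). int l * (b - 1) + int q + 1"
  let ?S = "SIGMA q:{..<l}. {b \<in> C q. of_int b = v - g q}"
  have inj: "inj_on ?pos ({..<l} \<times> UNIV)"
    by (rule inj_on_chi_position)
  have "{x \<in> chi l C. abacus_level l g x = v} = ?pos ` ?S"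
    unfolding chi_def by (intro set_eqI iffI; clarsimp simp: abacus_level_position image_iff Bex_def) fastforce+
  moreover have "card (?pos ` ?S) = card ?S"
    by (intro card_image inj_on_subset[OF inj]) auto
  \<comment> \<open>\<open>of_int\<close> embeds this set into a one-point set.\<close>
  moreover have "finite {b \<in> C q. (of_int b :: rat) = v - g q}" for q
    using finite_imageD[OF finite_subset[of "of_int ` {b \<in> C q. (of_int b :: rat) = v - g q}" "{v - g q}"]]
    by (auto simp: inj_on_def)
  ultimately show ?thesis by (simp add: bead_count_def card_SigmaI)
qed

section \<open>Bead counts and residues\<close>

text \<open>The argument is rational because the shifts \<open>h i\<close> are; a fractional
  \<open>t\<close> gives 0.\<close>

definition content_count :: "nat list \<Rightarrow> rat \<Rightarrow> nat" where
  "content_count \<nu> t = card {p \<in> young \<nu>. of_int (content p) = t}"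

text \<open>The first row has the contents from 0 to \<open>k - 1\<close> once each; the rows of
  \<open>\<nu>\<close> move down by one, which lowers their contents by one.\<close>

lemma card_content_Cons:
  "card {p \<in> young (k # \<nu>). content p = c} =
    of_bool (0 \<le> c \<and> c < int k) + card {p \<in> young \<nu>. content p = c + 1}"
proof -
  let ?A = "{p \<in> (\<lambda>b. (1, b)) ` {1..k}. content p = c}"
  let ?B = "(\<lambda>(a, b). (Suc a, b)) ` {p \<in> young \<nu>. content p = c + 1}"
  have "{p \<in> young (k # \<nu>). content p = c} = ?A \<union> ?B"
    by (auto simp: young_Cons content_def image_iff)
  moreover have "?A = (if 0 \<le> c \<and> c < int k then {(1, nat c + 1)} else {})"
    by (auto simp: content_def image_iff)
  moreover have "?A \<inter> ?B = {}" by (auto simp: young_def)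
  moreover have "card ?B = card {p \<in> young \<nu>. content p = c + 1}"
    by (rule card_image) (auto simp: inj_on_def)
  ultimately show ?thesis by (simp add: card_Un_disjoint)
qed

text \<open>The identity \<open>\<Sum>\<^sub>i (x\<^bsup>\<nu> i + 1 - i\<^esup> - x\<^bsup>1 - i\<^esup>) = (x - 1) Res(x)\<close>, coefficient by coefficient.\<close>

lemma beta_set_content:
  assumes "is_partition \<nu>"
  shows "of_bool (c \<in> beta_set s \<nu>) + card {p \<in> young \<nu>. content p = c - s}
    = of_bool (c \<le> s) + card {p \<in> young \<nu>. content p = c - s - 1}"
  using assms
proof (induction \<nu> arbitrary: s)
  case Nil
  then show ?case by (simp add: beta_set_Nil)
next
  case (Cons k \<nu>)
  have "int k + s \<notin> beta_set (s - 1) \<nu>"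
    using beta_set_le[of \<nu> k "int k + s" "s - 1"] Cons.prems by (auto simp: is_partition_Cons)
  then have "of_bool (c \<in> beta_set s (k # \<nu>))
      = (of_bool (c = int k + s) + of_bool (c \<in> beta_set (s - 1) \<nu>) :: nat)"
    by (auto simp: beta_set_Cons)
  moreover have "of_bool (c \<in> beta_set (s - 1) \<nu>) + card {p \<in> young \<nu>. content p = c - s + 1}
    = of_bool (c \<le> s - 1) + card {p \<in> young \<nu>. content p = c - s}"
    using Cons.IH[of "s - 1"] Cons.prems by (simp add: is_partition_Cons algebra_simps)
  \<comment> \<open>For the new row this is \<open>x^k - 1 = (x - 1) (1 + ... + x^(k - 1))\<close>,
    read off at the exponent \<open>c - s\<close>.\<close>
  moreover have "of_bool (c = int k + s) + of_bool (c \<le> s - 1) + of_bool (0 \<le> c - s \<and> c - s < int k)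
    = (of_bool (c \<le> s) + of_bool (0 \<le> c - s - 1 \<and> c - s - 1 < int k) :: nat)"
    by auto
  ultimately show ?case unfolding card_content_Cons by (simp only: diff_add_cancel)
qed

text \<open>Carries \<open>beta_set_content\<close> over to rational exponents; for fractional
  \<open>t\<close> all the sets are empty.\<close>

lemma beta_set_content_count:
  assumes "is_partition \<nu>"
  shows "card {b \<in> beta_set s \<nu>. of_int b = t} + content_count \<nu> (t - of_int s)
    = card {b \<in> {..s}. of_int b = t} + content_count \<nu> (t - of_int s - 1)"
proof (cases "t \<in> \<int>")
  case True
  then obtain c where c: "t = of_int c" by (auto elim: Ints_cases)
  have b: "card {b \<in> X. (of_int b :: rat) = t} = of_bool (c \<in> X)" for X
  proof -
    have "{b \<in> X. (of_int b :: rat) = t} = (if c \<in> X then {c} else {})" by (auto simp: c)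
    then show ?thesis by simp
  qed
  have "content_count \<nu> (t - of_int s) = card {p \<in> young \<nu>. content p = c - s}"
    "content_count \<nu> (t - of_int s - 1) = card {p \<in> young \<nu>. content p = c - s - 1}"
    using of_int_eq_iff[of _ "c - s", where 'a = rat] of_int_eq_iff[of _ "c - s - 1", where 'a = rat]
    by (simp_all add: content_count_def c)
  then show ?thesis using beta_set_content[OF assms, of c s] unfolding b by (simp only: atMost_iff)
next
  case False
  have no: "of_int b \<noteq> t" "of_int b \<noteq> t - of_int s" "of_int b \<noteq> t - of_int s - 1" for b
  proof -
    show "of_int b \<noteq> t" using False by auto
    show "of_int b \<noteq> t - of_int s"
      using False Ints_of_int[of "b + s", where 'a = rat] by (auto simp: eq_diff_eq)
    show "of_int b \<noteq> t - of_int s - 1"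
      using False Ints_of_int[of "b + 1 + s", where 'a = rat] by (auto simp: eq_diff_eq)
  qed
  show ?thesis by (simp add: content_count_def no)
qed

text \<open>The coefficient at the rational exponent \<open>v\<close> of the sum of
  \<open>x^(h i) Res(x)\<close> over the components.\<close>

definition charged_residue :: "nat \<Rightarrow> (nat \<Rightarrow> rat) \<Rightarrow> (nat \<Rightarrow> nat list) \<Rightarrow> rat \<Rightarrow> nat" where
  "charged_residue l h \<nu> v = (\<Sum>i<l. content_count (\<nu> i) (v - h i))"

text \<open>On runner \<open>q\<close> the charge \<open>r q\<close> cancels the shift inside
  \<open>g q\<close> and leaves \<open>h q\<close>. The two residue terms carry the factor
  \<open>x - 1\<close>, and the sum over \<open>{..r q}\<close> is the same for every
  \<open>\<nu>\<close>.\<close>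

lemma bead_count_chi_residue:
  assumes "\<And>q. q < l \<Longrightarrow> is_partition (\<nu> q)" "\<And>q. q < l \<Longrightarrow> g q = h q - of_int (r q)"
  shows "bead_count (abacus_level l g) (chi l (\<lambda>q. beta_set (r q) (\<nu> q))) v + charged_residue l h \<nu> v
    = (\<Sum>q<l. card {b \<in> {..r q}. of_int b = v - g q}) + charged_residue l h \<nu> (v - 1)"
proof -
  have "card {b \<in> beta_set (r q) (\<nu> q). of_int b = v - g q} + content_count (\<nu> q) (v - h q)
    = card {b \<in> {..r q}. of_int b = v - g q} + content_count (\<nu> q) (v - 1 - h q)" if "q < l" for q
  proof -
    have "v - g q - of_int (r q) = v - h q" "v - g q - of_int (r q) - 1 = v - 1 - h q"
      using assms(2)[OF that] by simp_all
    then show ?thesis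
      using beta_set_content_count[OF assms(1)[OF that], of "r q" "v - g q"] by (simp only:)
  qed
  then show ?thesis
    by (simp add: bead_count_chi charged_residue_def flip: sum.distrib)
qed

lemma finite_support_charged_residue: "finite {v. charged_residue l h \<nu> v \<noteq> 0}"
proof -
  have "{v. charged_residue l h \<nu> v \<noteq> 0} \<subseteq> (\<Union>i<l. (\<lambda>p. h i + of_int (content p)) ` young (\<nu> i))"
  proof
    fix v assume "v \<in> {v. charged_residue l h \<nu> v \<noteq> 0}"
    then obtain i where "i < l" "content_count (\<nu> i) (v - h i) \<noteq> 0"
      by (auto simp: charged_residue_def)
    then obtain p where "p \<in> young (\<nu> i)" "of_int (content p) = v - h i"
      by (auto simp: content_count_def)
    then have "v = h i + of_int (content p)" "p \<in> young (\<nu> i)" by simp_all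
    then show "v \<in> (\<Union>i<l. (\<lambda>p. h i + of_int (content p)) ` young (\<nu> i))"
      using \<open>i < l\<close> by blast
  qed
  then show ?thesis by (rule finite_subset) simp
qed

text \<open>This is why \<open>x - 1\<close> can be cancelled: a nonzero value of \<open>D\<close>
  would recur at \<open>v - 1\<close>, \<open>v - 2\<close> and so on.\<close>

lemma shift_invariant_finite_support:
  fixes D :: "rat \<Rightarrow> int"
  assumes "\<And>v. D (v - 1) = D v" "finite {v. D v \<noteq> 0}"
  shows "D v = 0"
proof (rule ccontr)
  assume "D v \<noteq> 0"
  have "D (v - of_nat k) = D v" for k
  proof (induction k)
    case (Suc k)
    then show ?case using assms(1)[of "v - of_nat k"] by (simp add: algebra_simps)
  qed simp
  then have "range (\<lambda>k::nat. v - of_nat k) \<subseteq> {v. D v \<noteq> 0}" using \<open>D v \<noteq> 0\<close> by auto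
  moreover have "inj (\<lambda>k::nat. v - of_nat k)" by (auto simp: inj_def)
  ultimately show False using assms(2) by (meson finite_imageD finite_subset infinite_UNIV_nat)
qed

lemma bead_count_eq_iff_residue_eq:
  assumes "\<And>q. q < l \<Longrightarrow> is_partition (\<nu> q)" "\<And>q. q < l \<Longrightarrow> is_partition (\<kappa> q)"
    "\<And>q. q < l \<Longrightarrow> g q = h q - of_int (r q)"
  shows "bead_count (abacus_level l g) (chi l (\<lambda>q. beta_set (r q) (\<nu> q)))
      = bead_count (abacus_level l g) (chi l (\<lambda>q. beta_set (r q) (\<kappa> q)))
    \<longleftrightarrow> charged_residue l h \<nu> = charged_residue l h \<kappa>"
proof -
  have \<nu>: "bead_count (abacus_level l g) (chi l (\<lambda>q. beta_set (r q) (\<nu> q))) v + charged_residue l h \<nu> v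
      = (\<Sum>q<l. card {b \<in> {..r q}. of_int b = v - g q}) + charged_residue l h \<nu> (v - 1)" for v
    by (rule bead_count_chi_residue[OF assms(1,3)])
  have \<kappa>: "bead_count (abacus_level l g) (chi l (\<lambda>q. beta_set (r q) (\<kappa> q))) v + charged_residue l h \<kappa> v
      = (\<Sum>q<l. card {b \<in> {..r q}. of_int b = v - g q}) + charged_residue l h \<kappa> (v - 1)" for v
    by (rule bead_count_chi_residue[OF assms(2,3)])
  show ?thesis
  proof
    assume eq: "charged_residue l h \<nu> = charged_residue l h \<kappa>"
    show "bead_count (abacus_level l g) (chi l (\<lambda>q. beta_set (r q) (\<nu> q)))
      = bead_count (abacus_level l g) (chi l (\<lambda>q. beta_set (r q) (\<kappa> q)))"
    proof
      fix v
      show "bead_count (abacus_level l g) (chi l (\<lambda>q. beta_set (r q) (\<nu> q))) v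
        = bead_count (abacus_level l g) (chi l (\<lambda>q. beta_set (r q) (\<kappa> q))) v"
        using \<nu>[of v] \<kappa>[of v] unfolding eq by simp
    qed
  next
    assume eq: "bead_count (abacus_level l g) (chi l (\<lambda>q. beta_set (r q) (\<nu> q)))
        = bead_count (abacus_level l g) (chi l (\<lambda>q. beta_set (r q) (\<kappa> q)))"
    \<comment> \<open>The terms common to \<open>\<nu>\<close> and \<open>\<kappa>\<close> cancel,
      so equal bead counts make this difference invariant under unit shifts.\<close>
    let ?D = "\<lambda>v. int (charged_residue l h \<nu> v) - int (charged_residue l h \<kappa> v)"
    have "?D (v - 1) = ?D v" for v
      using \<nu>[of v] \<kappa>[of v] unfolding eq by linarith
    moreover have "finite {v. ?D v \<noteq> 0}"
      by (rule finite_subset[OF _ finite_UnI[OF finite_support_charged_residue[of l h \<nu>]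
              finite_support_charged_residue[of l h \<kappa>]]]) auto
    ultimately have "?D v = 0" for v by (rule shift_invariant_finite_support)
    then show "charged_residue l h \<nu> = charged_residue l h \<kappa>" by (simp add: fun_eq_iff)
  qed
qed

text \<open>Components and shifts move together, so the sum is only reindexed; this removes the
  permutation from the criterion.\<close>

lemma charged_residue_permute:
  assumes "bij_betw \<sigma> {..<l} {..<l}"
  shows "charged_residue l (h \<circ> \<sigma>) (\<nu> \<circ> \<sigma>) = charged_residue l h \<nu>"
proof
  fix v
  show "charged_residue l (h \<circ> \<sigma>) (\<nu> \<circ> \<sigma>) v = charged_residue l h \<nu> v"
    using sum.reindex_bij_betw[OF assms, of "\<lambda>i. content_count (\<nu> i) (v - h i)"]
    by (simp add: charged_residue_def)
qed

text \<open>Substituting \<open>x^d\<close> for \<open>x\<close> turns the exponent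
  \<open>k / d\<close> into \<open>k\<close>.\<close>

lemma res_coeff_eq_charged_residue:
  assumes "0 < d"
  shows "res_coeff l d H lam k
    = int (charged_residue l (\<lambda>i. \<Sum>j\<in>{1..i}. H j) (\<lambda>i. lam ! i) (of_int k / of_nat d))"
proof -
  let ?h = "\<lambda>i. \<Sum>j\<in>{1..i}. H j"
  have "mbar d H i + of_int (int d * content p) = of_int k \<longleftrightarrow>
    of_int (content p) = of_int k / of_nat d - ?h i" for i p
    using assms by (auto simp: mbar_def field_simps)
  then have "{(i, p). i < l \<and> p \<in> young (lam ! i) \<and> mbar d H i + of_int (int d * content p) = of_int k}
    = (SIGMA i:{..<l}. {p \<in> young (lam ! i). of_int (content p) = of_int k / of_nat d - ?h i})"
    by auto
  then show ?thesis
    by (simp add: res_coeff_def charged_residue_def content_count_def card_SigmaI)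
qed

text \<open>The exponents \<open>k / d\<close> suffice: \<open>d * h i\<close> is integral for
  \<open>i < l\<close>, so no other exponent occurs.\<close>

lemma res_coeff_eq_iff:
  assumes "0 < d" "\<forall>i\<in>{1..<l}. of_nat d * H i \<in> \<int>"
  defines "h \<equiv> \<lambda>i. \<Sum>j\<in>{1..i}. H j"
  shows "res_coeff l d H lam = res_coeff l d H mu
    \<longleftrightarrow> charged_residue l h (\<lambda>i. lam ! i) = charged_residue l h (\<lambda>i. mu ! i)"
proof
  assume eq: "res_coeff l d H lam = res_coeff l d H mu"
  show "charged_residue l h (\<lambda>i. lam ! i) = charged_residue l h (\<lambda>i. mu ! i)"
  proof
    fix v
    show "charged_residue l h (\<lambda>i. lam ! i) v = charged_residue l h (\<lambda>i. mu ! i) v"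
    proof (cases "of_nat d * v \<in> \<int>")
      case True
      then obtain k where "of_nat d * v = of_int k" by (auto elim: Ints_cases)
      then have "v = of_int k / of_nat d" using assms(1) by (simp add: field_simps)
      then show ?thesis
        using fun_cong[OF eq, of k] by (simp add: res_coeff_eq_charged_residue[OF assms(1)] h_def)
    next
      case False
      have "of_int (content p) \<noteq> v - h i" if "i < l" for p i
      proof
        assume "of_int (content p) = v - h i"
        then have "of_nat d * v = of_nat d * of_int (content p) + (\<Sum>j\<in>{1..i}. of_nat d * H j)"
          by (simp add: h_def flip: sum_distrib_left distrib_left)
        moreover have "(\<Sum>j\<in>{1..i}. of_nat d * H j) \<in> \<int>"
          using assms(2) that by (intro Ints_sum) auto
        ultimately show False using False by (simp add: Ints_add Ints_mult)
      qed
      then have "charged_residue l h \<nu> v = 0" for \<nu>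
        by (auto simp: charged_residue_def content_count_def)
      then show ?thesis by simp
    qed
  qed
next
  assume "charged_residue l h (\<lambda>i. lam ! i) = charged_residue l h (\<lambda>i. mu ! i)"
  then show "res_coeff l d H lam = res_coeff l d H mu"
    by (simp add: fun_eq_iff res_coeff_eq_charged_residue[OF assms(1)] h_def)
qed

section \<open>The group action\<close>

lemma swap_nat_swap_nat [simp]: "swap_nat a b (swap_nat a b x) = x"
  by (simp add: swap_nat_def)

lemma bij_swap_nat: "bij (swap_nat a b)"
  by (rule o_bij[of "swap_nat a b"]) auto

lemma inv_swap_nat [simp]: "inv (swap_nat a b) = swap_nat a b"
  by (rule inv_equality) simp_all

lemma perm_word_Cons: "perm_word (i # ws) = swap_nat (i - 1) i \<circ> perm_word ws"
  by (simp add: perm_word_def)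

lemma bij_perm_word: "bij (perm_word ws)"
proof (induction ws)
  case Nil
  then show ?case by (simp add: perm_word_def bij_betw_def)
next
  case (Cons i ws)
  show ?case unfolding perm_word_Cons by (rule bij_comp[OF Cons bij_swap_nat])
qed

lemma inv_perm_word_Cons: "inv (perm_word (i # ws)) = inv (perm_word ws) \<circ> swap_nat (i - 1) i"
  by (simp add: perm_word_Cons o_inv_distrib bij_swap_nat bij_perm_word)

lemma bij_betw_inv_perm_word:
  assumes "\<forall>i\<in>set ws. 1 \<le> i \<and> i \<le> l - 1"
  shows "bij_betw (inv (perm_word ws)) {..<l} {..<l}"
  using assms
proof (induction ws)
  case Nil
  then show ?case by (simp add: perm_word_def bij_betw_def)
next
  case (Cons i ws)
  have "bij_betw (swap_nat (i - 1) i) {..<l} {..<l}"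
    by (rule bij_betw_byWitness[where f' = "swap_nat (i - 1) i"]) (use Cons.prems in \<open>auto simp: swap_nat_def\<close>)
  then show ?case
    unfolding inv_perm_word_Cons by (rule bij_betw_trans) (use Cons in auto)
qed

text \<open>Exchanging the two partial sums adds \<open>\<delta> * (e (i - 1) - e i)\<close> to
  \<open>h\<close>, with \<open>e\<close> the standard basis. The cyclic differences of this change
  are \<open>- \<delta> * alpha l i\<close>, and \<open>\<delta>\<close> is
  \<open>\<theta> i\<close>.\<close>

lemma act_gen_cyclic_diff:
  assumes "1 \<le> i" "i \<le> l - 1" "j < l" "\<And>j. j < l \<Longrightarrow> \<theta> j = cyclic_diff l h j"
  shows "act_gen l i \<theta> j = cyclic_diff l (h \<circ> swap_nat (i - 1) i) j"
proof -
  \<comment> \<open>The cyclic predecessor of \<open>j\<close>, so that position 0 needs no separate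
    treatment.\<close>
  define q where "q = (if j = 0 then l - 1 else j - 1)"
  define \<delta> where "\<delta> = h i - h (i - 1)"
  have cyc: "cyclic_diff l f j = of_bool (j = 0) + f j - f q" for f
    by (simp add: cyclic_diff_def q_def)
  have swap: "(h \<circ> swap_nat (i - 1) i) p = h p + \<delta> * (of_bool (p = i - 1) - of_bool (p = i))" for p
    using assms(1) by (cases "p = i"; cases "p = i - 1") (auto simp: swap_nat_def \<delta>_def)
  have mod: "i mod l = i" "(i + l - 1) mod l = i - 1"
    using assms(1,2) by (auto simp: mod_if)
  have "(i + 1) mod l = (if i = l - 1 then 0 else i + 1)"
    using assms(1,2) by auto
  \<comment> \<open>Expressing the neighbours through \<open>q\<close> also covers
    \<open>l = 2\<close>, where \<open>i - 1\<close> and \<open>i + 1\<close> agree modulo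
    \<open>l\<close>.\<close>
  then have next_i: "j = (i + 1) mod l \<longleftrightarrow> q = i" and eq_i: "j = i \<longleftrightarrow> q = i - 1"
    using assms(1-3) by (auto simp: q_def)
  have \<theta>: "\<theta> i = \<delta>" "\<theta> j = of_bool (j = 0) + h j - h q"
    using assms by (simp_all add: \<delta>_def cyclic_diff_def q_def)
  have "of_int (alpha l i j) = (2 * of_bool (j = i) - of_bool (j = i - 1) - of_bool (q = i) :: rat)"
    unfolding alpha_def mod next_i by simp
  moreover have "of_bool (q = i - 1) = (of_bool (j = i) :: rat)" by (simp add: eq_i)
  ultimately show ?thesis
    unfolding act_gen_def cyc swap mod \<theta> by (simp only:) (simp add: algebra_simps)
qed

text \<open>The letters act from the last to the first; the inverse makes composition on the right a
  left action.\<close>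

lemma act_word_cyclic_diff:
  assumes "\<forall>i\<in>set ws. 1 \<le> i \<and> i \<le> l - 1" "\<And>j. j < l \<Longrightarrow> \<theta> j = cyclic_diff l h j" "j < l"
  shows "act_word l ws \<theta> j = cyclic_diff l (h \<circ> inv (perm_word ws)) j"
  using assms(1,3)
proof (induction ws arbitrary: j)
  case Nil
  then show ?case using assms(2) by (simp add: act_word_def perm_word_def)
next
  case (Cons i ws)
  have "act_gen l i (act_word l ws \<theta>) j
      = cyclic_diff l (h \<circ> inv (perm_word ws) \<circ> swap_nat (i - 1) i) j"
  proof (rule act_gen_cyclic_diff)
    show "act_word l ws \<theta> j = cyclic_diff l (h \<circ> inv (perm_word ws)) j" if "j < l" for j
      by (rule Cons.IH) (use Cons.prems that in auto)
  qed (use Cons.prems in auto)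
  then show ?case unfolding inv_perm_word_Cons comp_assoc act_word_def foldr.simps o_apply .
qed

lemma theta_cyclic_diff: "0 < l \<Longrightarrow> theta l H j = cyclic_diff l (\<lambda>i. \<Sum>j\<in>{1..i}. H j) j"
proof (cases j)
  case 0
  assume "0 < l"
  then have "{1..<l} = {1..l - 1}" by auto
  then show ?thesis using 0 by (simp add: theta_def cyclic_diff_def)
next
  case (Suc i)
  then show ?thesis by (simp add: theta_def cyclic_diff_def)
qed

text \<open>\<open>phi l r\<close> is the cyclic difference of \<open>- r\<close> without the
  constant 1, so translating by it lowers \<open>h\<close> by \<open>r\<close>.\<close>

lemma cyclic_diff_phi:
  assumes "j < l"
  shows "cyclic_diff l h j + of_int (phi l r j) = cyclic_diff l (\<lambda>p. h p - of_int (r p)) j"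
proof (cases "j = 0")
  case True
  then show ?thesis using assms by (simp add: cyclic_diff_def phi_def)
next
  case False
  then have "(j + l - 1) mod l = j - 1" using assms by (simp add: mod_if)
  then show ?thesis using False by (simp add: cyclic_diff_def phi_def)
qed

theorem theorem3p13:
  fixes l n d :: nat and H :: "nat \<Rightarrow> rat" and r :: "nat \<Rightarrow> int" and ws :: "nat list"
    and lam mu :: "nat list list"
  assumes l_pos: "0 < l" and n_pos: "0 < n" and d_pos: "0 < d"
    and dH: "\<forall>i\<in>{1..<l}. of_nat d * H i \<in> \<int>"
    and r0: "(\<Sum>q<l. r q) = 0"
    and ws_gen: "\<forall>i\<in>set ws. 1 \<le> i \<and> i \<le> l - 1"
    and eps: "\<forall>j<l. 0 \<le> act_word l ws (theta l H) j + of_int (phi l r j)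
                  \<and> act_word l ws (theta l H) j + of_int (phi l r j) \<le> 1"
    and J_def: "J = {j. j < l \<and> act_word l ws (theta l H) j + of_int (phi l r j) = 0}"
    and lam: "is_multipartition l n lam" and mu: "is_multipartition l n mu"
  shows "J_heart l J (tau l r (perm_multi l (perm_word ws) lam))
           = J_heart l J (tau l r (perm_multi l (perm_word ws) mu))
         \<longleftrightarrow> res_coeff l d H lam = res_coeff l d H mu"
proof -
  define h where "h = (\<lambda>i. \<Sum>j\<in>{1..i}. H j)"
  define \<sigma> where "\<sigma> = inv (perm_word ws)"
  \<comment> \<open>The offsets of the runners, chosen so that their cyclic differences are the
    entries of \<epsilon>.\<close>
  define g where "g = (\<lambda>p. (h \<circ> \<sigma>) p - of_int (r p))"
  have \<sigma>: "bij_betw \<sigma> {..<l} {..<l}"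
    unfolding \<sigma>_def by (rule bij_betw_inv_perm_word[OF ws_gen])
  have act: "act_word l ws (theta l H) j + of_int (phi l r j) = cyclic_diff l g j" if "j < l" for j
    unfolding g_def cyclic_diff_phi[OF that, symmetric] \<sigma>_def
    using act_word_cyclic_diff[OF ws_gen _ that, of "theta l H" h] theta_cyclic_diff[OF l_pos]
    by (simp add: h_def comp_def)
  interpret level l J "abacus_level l g"
    by (rule level_abacus_level) (use l_pos eps act J_def in auto)
  have tau: "is_partition (tau l r (perm_multi l (perm_word ws) \<nu>))"
    "beta_set 0 (tau l r (perm_multi l (perm_word ws) \<nu>)) = chi l (\<lambda>q. beta_set (r q) (\<nu> ! \<sigma> q))"
    "\<And>q. q < l \<Longrightarrow> is_partition (\<nu> ! \<sigma> q)"
    if "is_multipartition l n \<nu>" for \<nu>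
  proof -
    show part: "is_partition (\<nu> ! \<sigma> q)" if "q < l" for q
      using bij_betwE[OF \<sigma>] that \<open>is_multipartition l n \<nu>\<close> by (simp add: is_multipartition_def)
    have nth: "perm_multi l (perm_word ws) \<nu> ! q = \<nu> ! \<sigma> q" if "q < l" for q
      using that by (simp add: perm_multi_def \<sigma>_def)
    have chi: "chi l (\<lambda>q. beta_set (r q) (perm_multi l (perm_word ws) \<nu> ! q))
        = chi l (\<lambda>q. beta_set (r q) (\<nu> ! \<sigma> q))"
      unfolding chi_def using nth by (metis (no_types, opaque_lifting))
    show "is_partition (tau l r (perm_multi l (perm_word ws) \<nu>))"
      "beta_set 0 (tau l r (perm_multi l (perm_word ws) \<nu>)) = chi l (\<lambda>q. beta_set (r q) (\<nu> ! \<sigma> q))"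
      unfolding chi[symmetric] by (rule tau_props[OF l_pos _ r0]; simp add: nth part)+
  qed
  have "J_heart l J (tau l r (perm_multi l (perm_word ws) lam))
           = J_heart l J (tau l r (perm_multi l (perm_word ws) mu))
    \<longleftrightarrow> bead_count (abacus_level l g) (chi l (\<lambda>q. beta_set (r q) (lam ! \<sigma> q)))
      = bead_count (abacus_level l g) (chi l (\<lambda>q. beta_set (r q) (mu ! \<sigma> q)))"
    using J_heart_eq_iff[OF tau(1)[OF lam] tau(1)[OF mu]] by (simp only: tau(2) lam mu)
  also have "\<dots> \<longleftrightarrow> charged_residue l (h \<circ> \<sigma>) (\<lambda>q. lam ! \<sigma> q) = charged_residue l (h \<circ> \<sigma>) (\<lambda>q. mu ! \<sigma> q)"
    by (rule bead_count_eq_iff_residue_eq) (use tau(3) lam mu in \<open>auto simp: g_def\<close>)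
  also have "\<dots> \<longleftrightarrow> charged_residue l h (\<lambda>i. lam ! i) = charged_residue l h (\<lambda>i. mu ! i)"
    using charged_residue_permute[OF \<sigma>, of h "\<lambda>i. lam ! i"]
      charged_residue_permute[OF \<sigma>, of h "\<lambda>i. mu ! i"] by (simp add: comp_def)
  also have "\<dots> \<longleftrightarrow> res_coeff l d H lam = res_coeff l d H mu"
    using res_coeff_eq_iff[OF d_pos dH] by (simp add: h_def)
  finally show ?thesis .
qed

end
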